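(* Let $\mathbb{F}\in\{\mathbb{R},\mathbb{C}\}$, let $n$ be a positive integer, let $A\in\mathbb{F}^{n\times n}$ and let $\varepsilon>0$. Then there exists an absolute norm $\|\cdot\|_{\mathbb{F}}$ on $\mathbb{F}^n$ whose induced operator norm satisfies $$\|A\|_{\mathbb{F}}\le\rho(A)+\varepsilon$$ if and only if $$\lim_{m\to\infty}\max\big\{(\rho(A)+\varepsilon)^{-k}\|AD_1AD_2\cdots AD_k\mathbf{x}\|_2 : D_1,\dots,D_k\in\mathcal{D}_n(\mathbb{F}),\ \mathbf{x}\in\mathbb{F}^n,\ \|\mathbf{x}\|_2=1,\ k\in\{1,\dots,m\}\big\}<\infty.$$
   Context: $\rho(A)$ is the spectral radius of $A$: the maximum modulus of all real and complex eigenvalues of $A$ (complex eigenvalues are included also when $\mathbb{F}=\mathbb{R}$). $\|\cdot\|_2$ is the Euclidean norm on $\mathbb{F}^n$. $\mathcal{D}_n(\mathbb{F})$ is the group of diagonal matrices in $\mathbb{F}^{n\times n}$ all of whose diagonal entries have absolute value $1$. For $\mathbf{x}=(x_1,\dots,x_n)^\top\in\mathbb{F}^n$ put $|\mathbf{x}|=(|x_1|,\dots,|x_n|)^\top$. A norm $\|\cdot\|_{\mathbb{F}}$ on the $\mathbb{F}$-vector space $\mathbb{F}^n$ is called absolute if $\|\mathbf{x}\|_{\mathbb{F}}=\||\mathbf{x}|\|_{\mathbb{F}}$ for all $\mathbf{x}\in\mathbb{F}^n$. The induced operator norm is $\|A\|_{\mathbb{F}}=\max\{\|A\mathbf{x}\|_{\mathbb{F}}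 : \mathbf{x}\in\mathbb{F}^n,\ \|\mathbf{x}\|_{\mathbb{F}}\le 1\}$. In the product $AD_1AD_2\cdots AD_k$ there are $k$ factors $A$, each followed by one of $D_1,\dots,D_k$. The maxima are nondecreasing in $m$, so the limit exists in $[0,\infty]$. *)

theory Defs
  imports "HOL-Analysis.Analysis"
begin

text \<open>
  The scalar field is the type variable \<open>'a\<close>, to be instantiated with \<^typ>\<open>real\<close> or
  \<^typ>\<open>complex\<close>, and \<open>n\<close> is \<open>CARD('n)\<close>. The library norm on \<open>'a ^ 'n\<close> is the Euclidean norm.
\<close>

definition eigenvalues :: "'a::field ^ 'n ^ 'n \<Rightarrow> 'a set" where
  "eigenvalues A = {c. \<exists>v. v \<noteq> 0 \<and> A *v v = c *s v}"

text \<open>A real matrix has to be mapped to a complex one first, so that its non-real eigenvalues count.\<close>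

definition spectral_radius :: "complex ^ 'n ^ 'n \<Rightarrow> real" where
  "spectral_radius A = Max (cmod ` eigenvalues A)"

text \<open>Homogeneity is over the full scalar field \<open>'a\<close>.\<close>

definition is_norm :: "('a::real_normed_field ^ 'n \<Rightarrow> real) \<Rightarrow> bool" where
  "is_norm N \<longleftrightarrow>
     (\<forall>x. 0 \<le> N x) \<and> (\<forall>x. N x = 0 \<longleftrightarrow> x = 0) \<and>
     (\<forall>c x. N (c *s x) = norm c * N x) \<and>
     (\<forall>x y. N (x + y) \<le> N x + N y)"

definition vabs :: "'a::real_normed_field ^ 'n \<Rightarrow> 'a ^ 'n" where
  "vabs x = (\<chi> i. of_real (norm (x $ i)))"

definition absolute_norm :: "('a::real_normed_field ^ 'n \<Rightarrow> real) \<Rightarrow> bool" where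
  "absolute_norm N \<longleftrightarrow> is_norm N \<and> (\<forall>x. N x = N (vabs x))"

text \<open>For a norm \<open>N\<close> on a space over the reals or complex numbers the supremum is attained,
  because the unit ball is compact; so it is the maximum.\<close>

definition op_norm :: "('a::real_normed_field ^ 'n \<Rightarrow> real) \<Rightarrow> 'a ^ 'n ^ 'n \<Rightarrow> real" where
  "op_norm N A = Sup {N (A *v x) | x. N x \<le> 1}"

definition unit_diag :: "('a::real_normed_field ^ 'n ^ 'n) set" where
  "unit_diag = {D. (\<forall>i j. i \<noteq> j \<longrightarrow> D $ i $ j = 0) \<and> (\<forall>i. norm (D $ i $ i) = 1)}"

text \<open>\<open>alt_prod A D k\<close> is \<open>A D\<^sub>1 A D\<^sub>2 \<dots> A D\<^sub>k\<close>.\<close>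

primrec alt_prod :: "'a::real_normed_field ^ 'n ^ 'n \<Rightarrow> (nat \<Rightarrow> 'a ^ 'n ^ 'n) \<Rightarrow> nat \<Rightarrow> 'a ^ 'n ^ 'n" where
  "alt_prod A D 0 = mat 1"
| "alt_prod A D (Suc k) = alt_prod A D k ** A ** D (Suc k)"

text \<open>Again the supremum is a maximum for \<open>m \<ge> 1\<close>, by compactness. It is taken in \<^typ>\<open>ennreal\<close>,
  where the limit as \<open>m \<rightarrow> \<infinity>\<close> always exists.\<close>

definition max_scaled_prod :: "'a::real_normed_field ^ 'n ^ 'n \<Rightarrow> real \<Rightarrow> nat \<Rightarrow> ennreal" where
  "max_scaled_prod A r m =
     Sup {ennreal (r powi (- int k) * norm (alt_prod A D k *v x)) | k D x.
            k \<in> {1..m} \<and> (\<forall>i\<in>{1..k}. D i \<in> unit_diag) \<and> norm x = 1}"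

lemma max_scaled_prod_tendsto_lim:
  "max_scaled_prod A r \<longlonglongrightarrow> lim (max_scaled_prod A r)"
proof -
  have "mono (max_scaled_prod A r)"
    unfolding max_scaled_prod_def by (intro monoI Sup_subset_mono) fastforce
  then show ?thesis
    using LIMSEQ_SUP limI by metis
qed

end

theory Submission
  imports Defs "HOL-Computational_Algebra.Fundamental_Theorem_Algebra"
begin

text \<open>
  Let \<open>r = \<rho>(A) + \<epsilon> > 0\<close>. An absolute norm \<open>N\<close> is invariant under \<^const>\<open>unit_diag\<close>, so
  \<open>N (A x) \<le> r N x\<close> gives \<open>N (A D\<^sub>1 \<dots> A D\<^sub>k x) \<le> r\<^sup>k N x\<close>, and \<open>N\<close> is equivalent to the
  Euclidean norm. Conversely, if the scaled products are bounded, then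
  \<open>N x = sup {r\<^sup>-\<^sup>k \<parallel>A D\<^sub>1 \<dots> A D\<^sub>k x\<parallel>\<^sub>2 | k \<ge> 0}\<close> is a norm. Absorbing a unit diagonal matrix into
  \<open>D\<^sub>k\<close> shows that it is absolute, and appending the factor \<open>D\<^sub>k\<^sub>+\<^sub>1 = I\<close> shows \<open>N (A x) \<le> r N x\<close>.
\<close>

subsection \<open>The spectral radius is nonnegative\<close>

text \<open>Evaluation at \<open>c\<close> is a ring homomorphism and so commutes with the Leibniz
  sum. This allows a determinant with polynomial entries to serve as characteristic
  polynomial.\<close>

lemma poly_of_entries_det:
  fixes P :: "'a::comm_ring_1 poly ^ 'n ^ 'n"
  shows "poly (det P) c = det (\<chi> i j. poly (P $ i $ j) c)"
  by (simp add: det_def poly_sum poly_prod)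

lemma continuous_on_det:
  fixes f :: "'b::topological_space \<Rightarrow> 'a::real_normed_field ^ 'n ^ 'n"
  assumes "\<And>i j. continuous_on S (\<lambda>x. f x $ i $ j)"
  shows "continuous_on S (\<lambda>x. det (f x))"
  unfolding det_def by (intro continuous_intros assms)

lemma det_scale:
  fixes M :: "'a::comm_ring_1 ^ 'n ^ 'n"
  shows "det (\<chi> i j. c * M $ i $ j) = c ^ CARD('n) * det M"
  by (simp add: det_def prod.distrib sum_distrib_left mult_ac)

lemma mem_eigenvalues_iff_det:
  fixes A :: "complex ^ 'n ^ 'n"
  shows "c \<in> eigenvalues A \<longleftrightarrow> det (mat c - A) = 0"
proof -
  have "(\<exists>v. v \<noteq> 0 \<and> A *v v = c *s v) \<longleftrightarrow> (\<exists>v. v \<noteq> 0 \<and> (mat c - A) *v v = 0)"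
  proof -
    have "mat c *v v = c *s v" for v :: "complex ^ 'n"
      by (simp add: vec_eq_iff matrix_vector_mult_def mat_def if_distrib[of "\<lambda>x. x * _"]
            cong: if_cong)
    then show ?thesis
      by (auto simp: matrix_vector_mult_diff_rdistrib)
  qed
  also have "\<dots> \<longleftrightarrow> \<not> invertible (mat c - A)"
    by (auto simp: invertible_left_inverse matrix_left_invertible_ker)
  finally show ?thesis
    by (simp add: eigenvalues_def invertible_det_nz)
qed

text \<open>The characteristic polynomial is nonconstant because
  \<open>det (c I - A) = c\<^sup>n det (I - A / c)\<close> tends to infinity with \<open>c\<close>.\<close>

lemma filterlim_char_poly:
  fixes A :: "complex ^ 'n ^ 'n"
  shows "filterlim (\<lambda>c. det (mat c - A)) at_infinity at_infinity"
proof -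
  define q where "q t = det (mat 1 - (\<chi> i j. t * A $ i $ j))" for t
  have "continuous_on UNIV q"
    unfolding q_def by (intro continuous_on_det) (auto intro!: continuous_intros)
  then have "isCont q 0"
    by (simp add: continuous_on_eq_continuous_at)
  moreover have "q 0 = 1"
  proof -
    have "(\<chi> i j. 0 * A $ i $ j) = 0"
      by (simp add: vec_eq_iff)
    then show ?thesis
      by (simp add: q_def)
  qed
  ultimately have "((\<lambda>c. q (inverse c)) \<longlongrightarrow> 1) at_infinity"
    using isCont_tendsto_compose[OF _ tendsto_inverse_0] by metis
  then have lim: "filterlim (\<lambda>c. q (inverse c) * c ^ CARD('n)) at_infinity at_infinity"
    by (intro tendsto_mult_filterlim_at_infinity[of _ 1] filterlim_power_at_infinity
          filterlim_ident) auto
  have "\<forall>\<^sub>F c in at_infinity. q (inverse c) * c ^ CARD('n) = det (mat c - A)"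
    using eventually_not_equal_at_infinity[of 0]
  proof eventually_elim
    case (elim c)
    have "mat c - A = (\<chi> i j. c * (mat 1 - (\<chi> i j. inverse c * A $ i $ j)) $ i $ j)"
      using elim by (simp add: vec_eq_iff mat_def field_simps)
    then show ?case
      by (simp only: det_scale q_def mult.commute)
  qed
  then show ?thesis
    using lim by (rule filterlim_mono_eventually[OF _ order_refl order_refl, rotated])
qed

text \<open>The eigenvalues are the roots of the characteristic polynomial, which is nonconstant.
  Both facts give meaning to the \<open>Max\<close> in \<open>spectral_radius\<close>, which is
  informative only for a finite nonempty set.\<close>

lemma finite_eigenvalues: "finite (eigenvalues A)"
  and eigenvalues_nonempty: "eigenvalues A \<noteq> {}"
  for A :: "complex ^ 'n ^ 'n"
proof -
  \<comment> \<open>The characteristic polynomial: the entries are those of X I - A, linear on the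
    diagonal and constant elsewhere.\<close>
  define p where "p = det (\<chi> i j. if i = j then [:- A $ i $ j, 1:] else [:- A $ i $ j:])"
  have p: "poly p c = det (mat c - A)" for c
    unfolding p_def poly_of_entries_det
    by (rule arg_cong[where f = det]) (simp add: vec_eq_iff mat_def)
  have not_const: "\<not> constant (poly p)"
  proof
    assume "constant (poly p)"
    then have "poly p c = poly p 0" for c
      by (metis constant_def)
    \<comment> \<open>A constant function would have to tend to infinity, although it converges to
      its value.\<close>
    then have "filterlim (\<lambda>_::complex. poly p 0) at_infinity at_infinity"
      using filterlim_char_poly[of A] unfolding p[symmetric] by (metis (no_types, lifting) ext)
    then show False
      using not_tendsto_and_filterlim_at_infinity[of at_infinity "\<lambda>_::complex. poly p 0"]
      by (auto simp: trivial_limit_at_infinity)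
  qed
  then show "eigenvalues A \<noteq> {}"
    using fundamental_theorem_of_algebra[of p] mem_eigenvalues_iff_det[of _ A] by (auto simp: p)
  have "p \<noteq> 0"
    using not_const by (auto simp: constant_def)
  then have "finite {c. poly p c = 0}"
    by (rule poly_roots_finite)
  then show "finite (eigenvalues A)"
    by (rule rev_finite_subset) (auto simp: p mem_eigenvalues_iff_det)
qed

lemma spectral_radius_nonneg: "0 \<le> spectral_radius A"
proof -
  obtain c where "c \<in> eigenvalues A"
    using eigenvalues_nonempty by blast
  then have "cmod c \<le> spectral_radius A"
    unfolding spectral_radius_def by (intro Max_ge) (auto intro: finite_eigenvalues)
  then show ?thesis
    by (rule order_trans[OF norm_ge_zero])
qed

subsection \<open>Unit diagonal matrices and absolute norms\<close>

lemma unit_diag_mult_vec: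
  fixes D :: "'a::real_normed_field ^ 'n ^ 'n"
  assumes "D \<in> unit_diag"
  shows "(D *v x) $ i = D $ i $ i * x $ i"
proof -
  have "(\<Sum>j\<in>UNIV. D $ i $ j * x $ j) = (\<Sum>j\<in>UNIV. if j = i then D $ i $ j * x $ j else 0)"
    using assms by (intro sum.cong) (auto simp: unit_diag_def)
  then show ?thesis
    by (simp add: matrix_vector_mult_def)
qed

lemma mat_1_in_unit_diag: "mat 1 \<in> unit_diag"
  by (auto simp: unit_diag_def mat_def)

lemma diag_in_unit_diag:
  assumes "\<And>i. norm (d i) = 1"
  shows "(\<chi> i j. if i = j then d i else 0) \<in> unit_diag"
  using assms by (auto simp: unit_diag_def)

lemma unit_diag_mult:
  fixes D E :: "'a::real_normed_field ^ 'n ^ 'n"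
  assumes "D \<in> unit_diag" "E \<in> unit_diag"
  shows "D ** E \<in> unit_diag"
proof -
  have "(\<Sum>k\<in>UNIV. D $ i $ k * E $ k $ j) =
      (\<Sum>k\<in>UNIV. if k = i then D $ i $ i * E $ i $ j else 0)" for i j
    using assms by (intro sum.cong) (auto simp: unit_diag_def)
  then have "(D ** E) $ i $ j = D $ i $ i * E $ i $ j" for i j
    by (simp add: matrix_matrix_mult_def)
  then show ?thesis
    using assms by (auto simp: unit_diag_def norm_mult)
qed

lemma vabs_unit_diag_mult:
  assumes "D \<in> unit_diag"
  shows "vabs (D *v x) = vabs x"
  using assms
  by (simp add: vabs_def vec_eq_iff unit_diag_mult_vec norm_mult) (simp add: unit_diag_def)

lemma vabs_eq_unit_diag_mult:
  fixes x :: "'a::real_normed_field ^ 'n"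
  obtains D where "D \<in> unit_diag" "x = D *v vabs x"
proof -
  \<comment> \<open>The phase of each component; a zero component has none, and 1 keeps the entry
    unimodular.\<close>
  define d where "d i = (if x $ i = 0 then 1 else x $ i / of_real (norm (x $ i)))" for i
  define D where "D = (\<chi> i j. if i = j then d i else 0)"
  have D: "D \<in> unit_diag"
    unfolding D_def by (rule diag_in_unit_diag) (simp add: d_def norm_divide)
  moreover have "x = D *v vabs x"
    by (simp add: vec_eq_iff unit_diag_mult_vec[OF D]) (simp add: D_def d_def vabs_def)
  ultimately show ?thesis
    by (rule that)
qed

text \<open>Being constant on the fibres of \<open>vabs\<close> is the same as being constant on the
  orbits of \<open>unit_diag\<close>, because \<open>vabs\<close> is invariant and the orbit of
  \<open>x\<close> contains \<open>vabs x\<close>.\<close>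

lemma absolute_norm_iff_unit_diag_invariant:
  "absolute_norm N \<longleftrightarrow> is_norm N \<and> (\<forall>D\<in>unit_diag. \<forall>x. N (D *v x) = N x)"
  unfolding absolute_norm_def by (metis vabs_unit_diag_mult vabs_eq_unit_diag_mult)

section \<open>Comparison of absolute norms with the Euclidean norm\<close>

lemma norm_vector_scalar_mult:
  fixes x :: "'a::real_normed_field ^ 'n"
  shows "norm (c *s x) = norm c * norm x"
  by (simp add: norm_vec_def norm_mult L2_set_right_distrib)

lemma norm_vabs: "norm (vabs x) = norm x"
  by (simp add: norm_vec_def vabs_def)

lemma norm_unit_diag_mult:
  assumes "D \<in> unit_diag"
  shows "norm (D *v x) = norm x"
  by (metis assms norm_vabs vabs_unit_diag_mult)

lemma is_norm_zero: "is_norm N \<Longrightarrow> N 0 = 0"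
  unfolding is_norm_def by blast

text \<open>Expand \<open>x\<close> in the standard basis and bound every coordinate by the
  Euclidean norm.\<close>

lemma is_norm_le:
  fixes N :: "'a::real_normed_field ^ 'n \<Rightarrow> real"
  assumes "is_norm N"
  shows "N x \<le> (\<Sum>i\<in>UNIV. N (axis i 1)) * norm x"
proof -
  have triangle: "N (\<Sum>i\<in>S. f i) \<le> (\<Sum>i\<in>S. N (f i))" if "finite S"
    for f :: "'n \<Rightarrow> 'a ^ 'n" and S
    using that
  proof induction
    case empty
    show ?case
      using is_norm_zero[OF assms] by simp
  next
    case (insert i S)
    have "N (f i + sum f S) \<le> N (f i) + N (sum f S)"
      using assms by (simp add: is_norm_def)
    then show ?case
      using insert by simp
  qed
  have "N x = N (\<Sum>i\<in>UNIV. x $ i *s axis i 1)"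
    by (simp add: basis_expansion)
  also have "\<dots> \<le> (\<Sum>i\<in>UNIV. N (x $ i *s axis i 1))"
    by (rule triangle) simp
  also have "\<dots> = (\<Sum>i\<in>UNIV. norm (x $ i) * N (axis i 1))"
    using assms by (simp add: is_norm_def)
  also have "\<dots> \<le> (\<Sum>i\<in>UNIV. norm x * N (axis i 1))"
    using assms by (intro sum_mono mult_right_mono) (auto simp: is_norm_def Finite_Cartesian_Product.norm_nth_le)
  finally show ?thesis
    by (simp add: sum_distrib_left mult.commute)
qed

text \<open>The component \<open>x\<^sub>i e\<^sub>i\<close> is the average of \<open>x\<close> and its image under the diagonal matrix that
  flips the signs of all other components.\<close>

lemma absolute_norm_ge_component:
  fixes N :: "'a::real_normed_field ^ 'n \<Rightarrow> real"
  assumes "absolute_norm N"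
  shows "norm (x $ i) * N (axis i 1) \<le> N x"
proof -
  define D :: "'a ^ 'n ^ 'n" where "D = (\<chi> k j. if k = j then if k = i then 1 else - 1 else 0)"
  have D: "D \<in> unit_diag"
    unfolding D_def by (rule diag_in_unit_diag) simp
  have N: "is_norm N" and inv: "N (D *v x) = N x"
    using assms D by (auto simp: absolute_norm_iff_unit_diag_invariant)
  have "(2 * x $ i) *s axis i 1 = x + D *v x"
    by (simp add: vec_eq_iff unit_diag_mult_vec[OF D]) (simp add: D_def axis_def)
  then have "norm (2 * x $ i) * N (axis i 1) = N (x + D *v x)"
    using N by (metis is_norm_def)
  also have "\<dots> \<le> N x + N (D *v x)"
    using N by (simp add: is_norm_def)
  finally show ?thesis
    by (simp add: inv norm_mult)
qed

text \<open>Summing the componentwise bounds gives an explicit constant, since the Euclidean norm is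
  at most the sum of the moduli of the components.\<close>

lemma norm_le_absolute_norm:
  fixes N :: "'a::real_normed_field ^ 'n \<Rightarrow> real"
  assumes "absolute_norm N"
  shows "norm x \<le> (\<Sum>i\<in>UNIV. inverse (N (axis i 1))) * N x"
proof -
  have "0 < N (axis i 1)" for i
    using assms axis_eq_0_iff[of i "1::'a"]
    by (metis absolute_norm_def is_norm_def order_le_less zero_neq_one)
  then have "norm (x $ i) \<le> inverse (N (axis i 1)) * N x" for i
    using absolute_norm_ge_component[OF assms, of x i] by (simp add: field_simps)
  then have "(\<Sum>i\<in>UNIV. norm (x $ i)) \<le> (\<Sum>i\<in>UNIV. inverse (N (axis i 1)) * N x)"
    by (intro sum_mono)
  moreover have "norm x \<le> (\<Sum>i\<in>UNIV. norm (x $ i))"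
    by (simp add: norm_vec_def L2_set_le_sum)
  ultimately show ?thesis
    by (simp add: sum_distrib_right)
qed

text \<open>Homogeneity reduces the claim to vectors with \<open>N y = 1\<close>. The real
  \<open>Sup\<close> bounds its set only if that set is bounded above, which follows from the
  two-sided comparison of \<open>N\<close> with the Euclidean norm.\<close>

lemma mult_vec_le_op_norm:
  fixes A :: "'a::real_normed_field ^ 'n ^ 'n"
  assumes "absolute_norm N"
  shows "N (A *v x) \<le> op_norm N A * N x"
proof -
  have N: "is_norm N"
    using assms by (simp add: absolute_norm_def)
  define C where "C = (\<Sum>i\<in>UNIV. N (axis i 1))"
  define c where "c = (\<Sum>i\<in>UNIV. inverse (N (axis i 1)))"
  \<comment> \<open>The sum of the moduli of all entries bounds the Euclidean operator norm of
    \<open>A\<close>.\<close>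
  define E where "E = (\<Sum>i\<in>UNIV. \<Sum>j\<in>UNIV. norm (A $ i $ j))"
  have nonneg: "0 \<le> C" "0 \<le> c" "0 \<le> E"
    using N by (auto simp: C_def c_def E_def is_norm_def intro!: sum_nonneg)
  have E: "norm (A *v y) \<le> E * norm y" for y
  proof -
    have "norm (A *v y) \<le> (\<Sum>i\<in>UNIV. norm ((A *v y) $ i))"
      by (simp add: norm_vec_def L2_set_le_sum)
    also have "\<dots> \<le> (\<Sum>i\<in>UNIV. \<Sum>j\<in>UNIV. norm (A $ i $ j) * norm y)"
      unfolding matrix_vector_mult_def
      by (auto intro!: sum_mono sum_norm_le mult_left_mono simp: norm_mult Finite_Cartesian_Product.norm_nth_le)
    finally show ?thesis
      by (simp add: E_def sum_distrib_right)
  qed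
  have bdd: "bdd_above {N (A *v y) | y. N y \<le> 1}"
  proof (rule bdd_aboveI, safe)
    fix y assume y: "N y \<le> 1"
    have "N (A *v y) \<le> C * norm (A *v y)"
      unfolding C_def by (rule is_norm_le[OF N])
    also have "\<dots> \<le> C * (E * norm y)"
      using E nonneg by (intro mult_left_mono)
    also have "\<dots> \<le> C * (E * (c * N y))"
      unfolding c_def using nonneg norm_le_absolute_norm[OF assms] by (intro mult_left_mono)
    also have "\<dots> \<le> C * (E * (c * 1))"
      using nonneg y by (intro mult_left_mono)
    finally show "N (A *v y) \<le> C * (E * (c * 1))" .
  qed
  show ?thesis
  proof (cases "x = 0")
    case True
    then show ?thesis
      using is_norm_zero[OF N] by simp
  next
    case False
    then have pos: "0 < N x"
      using N by (metis is_norm_def order_le_less)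
    define y where "y = of_real (inverse (N x)) *s x"
    have "N y = inverse (N x) * N x"
      using N pos by (simp add: y_def is_norm_def norm_inverse)
    then have "N y = 1"
      using pos by simp
    moreover have "N (A *v y) = N (A *v x) / N x"
      using N pos unfolding y_def vector_scalar_commute
      by (simp add: is_norm_def norm_inverse divide_inverse)
    ultimately have "N (A *v x) / N x \<in> {N (A *v y) | y. N y \<le> 1}"
      by (metis (mono_tags, lifting) mem_Collect_eq order_refl)
    then have "N (A *v x) / N x \<le> op_norm N A"
      unfolding op_norm_def by (rule cSup_upper[OF _ bdd])
    then show ?thesis
      using pos by (simp add: field_simps)
  qed
qed

subsection \<open>Alternating products\<close>

lemma alt_prod_cong:
  assumes "\<And>i. i \<in> {1..k} \<Longrightarrow> D i = D' i"
  shows "alt_prod A D k = alt_prod A D' k"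
  using assms by (induction k) auto

lemma alt_prod_Suc_mult_vec:
  "alt_prod A D (Suc k) *v x = alt_prod A D k *v (A *v (D (Suc k) *v x))"
  by (simp flip: matrix_vector_mul_assoc)

text \<open>Peel off the rightmost pair: the diagonal factor preserves \<open>N\<close> and
  \<open>A\<close> enlarges it by at most \<open>r\<close>. The induction leaves \<open>x\<close>
  arbitrary because the remaining product acts on a new vector.\<close>

lemma absolute_norm_alt_prod_le:
  assumes "absolute_norm N" "op_norm N A \<le> r" "0 \<le> r" "\<forall>i\<in>{1..k}. D i \<in> unit_diag"
  shows "N (alt_prod A D k *v x) \<le> r ^ k * N x"
  using assms(4)
proof (induction k arbitrary: x)
  case 0
  then show ?case
    by simp
next
  case (Suc k)
  define y where "y = D (Suc k) *v x"
  have y: "N y = N x" and nonneg: "0 \<le> N y"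
    using assms(1) Suc.prems by (auto simp: y_def absolute_norm_iff_unit_diag_invariant is_norm_def)
  have "N (alt_prod A D (Suc k) *v x) \<le> r ^ k * N (A *v y)"
    unfolding alt_prod_Suc_mult_vec y_def using Suc by simp
  also have "\<dots> \<le> r ^ k * (op_norm N A * N y)"
    using mult_vec_le_op_norm[OF assms(1)] assms(3) by (intro mult_left_mono) auto
  also have "\<dots> \<le> r ^ k * (r * N y)"
    using assms(2,3) nonneg by (intro mult_left_mono mult_right_mono) auto
  finally show ?case
    by (simp add: y mult_ac del: alt_prod.simps)
qed

section \<open>Finiteness of the limit as a uniform bound on scaled products\<close>

lemma max_scaled_prod_le_lim: "max_scaled_prod A r m \<le> lim (max_scaled_prod A r)"
proof (rule incseq_le[OF _ max_scaled_prod_tendsto_lim])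
  show "incseq (max_scaled_prod A r)"
    unfolding max_scaled_prod_def by (intro monoI Sup_subset_mono) fastforce
qed

lemma lim_max_scaled_prod_finite:
  fixes A :: "'a::real_normed_field ^ 'n ^ 'n"
  assumes "absolute_norm N" "op_norm N A \<le> r" "0 < r"
  shows "lim (max_scaled_prod A r) < \<infinity>"
proof -
  define C where "C = (\<Sum>i\<in>UNIV. N (axis i 1))"
  define c where "c = (\<Sum>i\<in>UNIV. inverse (N (axis i 1)))"
  have N: "is_norm N"
    using assms by (simp add: absolute_norm_def)
  have c: "0 \<le> c"
    using N by (auto simp: c_def is_norm_def intro!: sum_nonneg)
  have "r powi (- int k) * norm (alt_prod A D k *v x) \<le> c * C"
    if "\<forall>i\<in>{1..k}. D i \<in> unit_diag" "norm x = 1" for k :: nat and D and x :: "'a ^ 'n"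
  proof -
    have "norm (alt_prod A D k *v x) \<le> c * N (alt_prod A D k *v x)"
      unfolding c_def by (rule norm_le_absolute_norm[OF assms(1)])
    also have "\<dots> \<le> c * (r ^ k * N x)"
      using c absolute_norm_alt_prod_le[OF assms(1,2)] assms(3) that by (intro mult_left_mono) auto
    also have "\<dots> \<le> c * (r ^ k * C)"
      using c assms(3) is_norm_le[OF N, of x] that unfolding C_def by (intro mult_left_mono) auto
    finally show ?thesis
      using assms(3) by (simp add: power_int_minus field_simps)
  qed
  then have "max_scaled_prod A r m \<le> ennreal (c * C)" for m
    unfolding max_scaled_prod_def by (intro Sup_least) (auto intro!: ennreal_leI)
  then have "lim (max_scaled_prod A r) \<le> ennreal (c * C)"
    by (intro LIMSEQ_le_const2[OF max_scaled_prod_tendsto_lim]) auto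
  also have "\<dots> < \<infinity>"
    by simp
  finally show ?thesis .
qed

text \<open>Each scaled product occurs in some \<open>max_scaled_prod A r k\<close>, hence lies
  below the limit. Rescaling extends the bound from Euclidean unit vectors to all
  \<open>x\<close>.\<close>

lemma scaled_prod_bounded:
  fixes A :: "'a::real_normed_field ^ 'n ^ 'n"
  assumes "lim (max_scaled_prod A r) < \<infinity>" "0 < r"
  obtains M where "\<And>k D x. \<forall>i\<in>{1..k}. D i \<in> unit_diag \<Longrightarrow>
    r powi (- int k) * norm (alt_prod A D k *v x) \<le> M * norm x"
proof -
  obtain L where L: "0 \<le> L" "lim (max_scaled_prod A r) = ennreal L"
    using assms(1) by (cases "lim (max_scaled_prod A r)") auto
  \<comment> \<open>The maxima start at \<open>k = 1\<close>; the 1 in \<open>max 1 L\<close> covers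
    the empty product, which is the identity.\<close>
  have unit: "r powi (- int k) * norm (alt_prod A D k *v x) \<le> max 1 L"
    if D: "\<forall>i\<in>{1..k}. D i \<in> unit_diag" and x: "norm x = 1" for k :: nat and D and x :: "'a ^ 'n"
  proof (cases "k = 0")
    case True
    then show ?thesis
      using x by simp
  next
    case False
    then have "ennreal (r powi (- int k) * norm (alt_prod A D k *v x)) \<le> max_scaled_prod A r k"
      unfolding max_scaled_prod_def using D x by (intro Sup_upper) fastforce
    also have "\<dots> \<le> ennreal L"
      using max_scaled_prod_le_lim[of A r k] L by simp
    finally show ?thesis
      using L by (simp add: ennreal_le_iff)
  qed
  show ?thesis
  proof
    fix k :: nat and D :: "nat \<Rightarrow> 'a ^ 'n ^ 'n" and x :: "'a ^ 'n"
    assume D: "\<forall>i\<in>{1..k}. D i \<in> unit_diag"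
    show "r powi (- int k) * norm (alt_prod A D k *v x) \<le> max 1 L * norm x"
    proof (cases "x = 0")
      case False
      define y where "y = of_real (inverse (norm x)) *s x"
      have "norm y = 1"
        using False by (simp add: y_def norm_vector_scalar_mult norm_inverse)
      then have "r powi (- int k) * norm (alt_prod A D k *v y) \<le> max 1 L"
        by (rule unit[OF D])
      moreover have "norm (alt_prod A D k *v y) = norm (alt_prod A D k *v x) / norm x"
        unfolding y_def vector_scalar_commute
        by (simp add: norm_vector_scalar_mult norm_inverse divide_inverse)
      ultimately show ?thesis
        using False by (simp add: field_simps)
    qed simp
  qed
qed

section \<open>The absolute norm built from bounded products\<close>

lemma absolute_norm_from_bounded_prod:
  fixes A :: "'a::real_normed_field ^ 'n ^ 'n"
  assumes r: "0 < r"
    and M: "\<And>k D x. \<forall>i\<in>{1..k}. D i \<in> unit_diag \<Longrightarrow>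
      r powi (- int k) * norm (alt_prod A D k *v x) \<le> M * norm x"
  shows "\<exists>N. absolute_norm N \<and> op_norm N A \<le> r"
proof -
  define S where "S x = {r powi (- int k) * norm (alt_prod A D k *v x) | k D.
    \<forall>i\<in>{1..k}. D i \<in> unit_diag}" for x
  define N where "N x = Sup (S x)" for x
  have bdd: "bdd_above (S x)" for x
    using M by (intro bdd_aboveI[of _ "M * norm x"]) (auto simp: S_def)
  \<comment> \<open>The empty product \<open>k = 0\<close> puts the Euclidean norm into the set, so
    \<open>N\<close> dominates it and is definite.\<close>
  have norm_in: "norm x \<in> S x" for x
    unfolding S_def by (rule CollectI, rule exI[of _ 0]) auto
  have upper: "r powi (- int k) * norm (alt_prod A D k *v x) \<le> N x"
    if "\<forall>i\<in>{1..k}. D i \<in> unit_diag" for k D x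
    unfolding N_def using that by (intro cSup_upper[OF _ bdd]) (auto simp: S_def)
  have least: "N x \<le> b"
    if "\<And>k D. \<forall>i\<in>{1..k}. D i \<in> unit_diag \<Longrightarrow>
      r powi (- int k) * norm (alt_prod A D k *v x) \<le> b" for x b
    unfolding N_def
  proof (rule cSup_least)
    show "S x \<noteq> {}"
      using norm_in by blast
  qed (use that in \<open>auto simp: S_def\<close>)
  have norm_le: "norm x \<le> N x" for x
    unfolding N_def by (rule cSup_upper[OF norm_in bdd])
  have N_0: "N 0 = 0"
    using norm_le[of 0] by (intro antisym least) auto
  have scale_le: "N (c *s x) \<le> norm c * N x" for c x
  proof (rule least)
    fix k :: nat and D assume "\<forall>i\<in>{1..k}. D i \<in> (unit_diag :: ('a ^ 'n ^ 'n) set)"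
    from mult_left_mono[OF upper[OF this, of x] norm_ge_zero[of c]]
    show "r powi (- int k) * norm (alt_prod A D k *v (c *s x)) \<le> norm c * N x"
      by (simp add: vector_scalar_commute norm_vector_scalar_mult mult_ac)
  qed
  have scale: "N (c *s x) = norm c * N x" for c x
  proof (cases "c = 0")
    case True
    then show ?thesis
      by (simp add: N_0)
  next
    case False
    \<comment> \<open>The reverse inequality is \<open>scale_le\<close> for the inverse
      scalar.\<close>
    have "N x = N (inverse c *s (c *s x))"
      using False by simp
    also have "\<dots> \<le> norm (inverse c) * N (c *s x)"
      by (rule scale_le)
    finally have "norm c * N x \<le> N (c *s x)"
      using False by (simp add: norm_inverse) (simp add: field_simps)
    then show ?thesis
      using scale_le[of c x] by simp
  qed
  have triangle: "N (x + y) \<le> N x + N y" for x y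
  proof (rule least)
    fix k :: nat and D assume D: "\<forall>i\<in>{1..k}. D i \<in> (unit_diag :: ('a ^ 'n ^ 'n) set)"
    let ?P = "alt_prod A D k"
    have "r powi (- int k) * norm (?P *v (x + y)) \<le>
        r powi (- int k) * (norm (?P *v x) + norm (?P *v y))"
      using r by (intro mult_left_mono)
        (auto simp: matrix_vector_right_distrib norm_triangle_ineq)
    also have "\<dots> \<le> N x + N y"
      using upper[OF D, of x] upper[OF D, of y] by (simp add: distrib_left)
    finally show "r powi (- int k) * norm (?P *v (x + y)) \<le> N x + N y" .
  qed
  have "is_norm N"
    unfolding is_norm_def
  proof (intro conjI allI)
    fix x
    show "0 \<le> N x"
      using norm_le[of x] norm_ge_zero[of x] by linarith
    show "N x = 0 \<longleftrightarrow> x = 0"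
      using norm_le[of x] N_0 by auto
  qed (fact scale triangle)+
  moreover have "N (E *v x) = N x" if E: "E \<in> unit_diag" for E x
  proof -
    \<comment> \<open>One inequality suffices: used for \<open>E\<close> and for its inverse, it
      gives equality.\<close>
    have le: "N (F *v z) \<le> N z" if F: "F \<in> unit_diag" for F z
    proof (rule least)
      fix k :: nat and D assume D: "\<forall>i\<in>{1..k}. D i \<in> (unit_diag :: ('a ^ 'n ^ 'n) set)"
      show "r powi (- int k) * norm (alt_prod A D k *v (F *v z)) \<le> N z"
      proof (cases k)
        \<comment> \<open>The empty product has no last diagonal factor to absorb \<open>F\<close>,
          but the Euclidean norm is itself invariant under \<open>F\<close>.\<close>
        case 0
        then show ?thesis
          using F norm_le[of z] by (simp add: norm_unit_diag_mult)
      next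
        case (Suc l)
        define D' where "D' = D(k := D k ** F)"
        have "alt_prod A D' l = alt_prod A D l"
          by (rule alt_prod_cong) (auto simp: D'_def Suc)
        then have "alt_prod A D' k *v z = alt_prod A D k *v (F *v z)"
          by (simp only: Suc alt_prod_Suc_mult_vec)
            (simp add: D'_def Suc matrix_vector_mul_assoc)
        moreover have "\<forall>i\<in>{1..k}. D' i \<in> unit_diag"
          using D F by (auto simp: D'_def Suc unit_diag_mult)
        ultimately show ?thesis
          using upper[of k D' z] by simp
      qed
    qed
    obtain F where F: "F \<in> unit_diag" "x = F *v (E *v x)"
    proof
      define F where "F = (\<chi> i j. if i = j then inverse (E $ i $ i) else 0)"
      show F: "F \<in> unit_diag"
        unfolding F_def using E by (intro diag_in_unit_diag) (auto simp: unit_diag_def norm_inverse)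
      have "E $ i $ i \<noteq> 0" for i
        using E by (auto simp: unit_diag_def dest: spec[of _ i])
      then show "x = F *v (E *v x)"
        using E F by (simp add: vec_eq_iff unit_diag_mult_vec) (simp add: F_def)
    qed
    then have "N x \<le> N (E *v x)"
      using le[of F "E *v x"] by simp
    then show ?thesis
      using le[OF E, of x] by simp
  qed
  ultimately have "absolute_norm N"
    by (simp add: absolute_norm_iff_unit_diag_invariant)
  moreover have "op_norm N A \<le> r"
    unfolding op_norm_def
  proof (rule cSup_least)
    have "N 0 \<le> 1"
      by (simp add: N_0)
    then show "{N (A *v x) | x. N x \<le> 1} \<noteq> {}"
      by blast
  next
    have "N (A *v x) \<le> r * N x" for x
    proof (rule least)
      fix k :: nat and D assume D: "\<forall>i\<in>{1..k}. D i \<in> (unit_diag :: ('a ^ 'n ^ 'n) set)"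
      define D' where "D' = D(Suc k := mat 1)"
      have "alt_prod A D' k = alt_prod A D k"
        by (rule alt_prod_cong) (auto simp: D'_def)
      then have "alt_prod A D' (Suc k) *v x = alt_prod A D k *v (A *v x)"
        unfolding alt_prod_Suc_mult_vec by (simp add: D'_def)
      moreover have "\<forall>i\<in>{1..Suc k}. D' i \<in> unit_diag"
        using D by (auto simp: D'_def mat_1_in_unit_diag)
      ultimately have "r powi (- int (Suc k)) * norm (alt_prod A D k *v (A *v x)) \<le> N x"
        using upper[of "Suc k" D' x] by simp
      \<comment> \<open>The appended step raises the length to \<open>Suc k\<close>; the resulting
        extra division by \<open>r\<close> becomes the factor \<open>r\<close> in the bound.\<close>
      moreover have "r powi (- int (Suc k)) = r powi (- int k) / r"
        unfolding power_int_minus power_int_of_nat using r by (simp add: field_simps)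
      ultimately have "r powi (- int k) * norm (alt_prod A D k *v (A *v x)) / r \<le> N x"
        by simp
      then show "r powi (- int k) * norm (alt_prod A D k *v (A *v x)) \<le> r * N x"
        using r by (simp only: pos_divide_le_eq mult.commute[of r])
    qed
    moreover have "r * N x \<le> r" if "N x \<le> 1" for x
      using that r by simp
    ultimately show "a \<le> r" if "a \<in> {N (A *v x) | x. N x \<le> 1}" for a
      using that order_trans by blast
  qed
  ultimately show ?thesis
    by blast
qed

text \<open>Stated for any real normed field and any positive \<open>r\<close>, this covers the real
  and the complex case at once; nonnegativity of the spectral radius makes \<open>r\<close> positive
  there.\<close>

lemma absolute_norm_exists_iff:
  fixes A :: "'a::real_normed_field ^ 'n ^ 'n"
  assumes "0 < r"
  shows "(\<exists>N. absolute_norm N \<and> op_norm N A \<le> r) \<longleftrightarrow> lim (max_scaled_prod A r) < \<infinity>"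
proof
  assume "lim (max_scaled_prod A r) < \<infinity>"
  then obtain M where "\<And>k D x. \<forall>i\<in>{1..k}. D i \<in> unit_diag \<Longrightarrow>
      r powi (- int k) * norm (alt_prod A D k *v x) \<le> M * norm x"
    using scaled_prod_bounded[OF _ assms] by metis
  then show "\<exists>N. absolute_norm N \<and> op_norm N A \<le> r"
    by (rule absolute_norm_from_bounded_prod[OF assms])
qed (use assms lim_max_scaled_prod_finite in blast)

theorem theorem3p4:
  fixes A :: "real ^ 'n ^ 'n" and B :: "complex ^ 'n ^ 'n" and \<epsilon> :: real
  assumes "\<epsilon> > 0"
  shows "((\<exists>N :: real ^ 'n \<Rightarrow> real. absolute_norm N \<and>
             op_norm N A \<le> spectral_radius (map_matrix complex_of_real A) + \<epsilon>) \<longleftrightarrow>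
           lim (max_scaled_prod A (spectral_radius (map_matrix complex_of_real A) + \<epsilon>)) < \<infinity>)
         \<and>
         ((\<exists>N :: complex ^ 'n \<Rightarrow> real. absolute_norm N \<and>
             op_norm N B \<le> spectral_radius B + \<epsilon>) \<longleftrightarrow>
           lim (max_scaled_prod B (spectral_radius B + \<epsilon>)) < \<infinity>)"
proof -
  have "0 < spectral_radius C + \<epsilon>" for C :: "complex ^ 'n ^ 'n"
    using assms spectral_radius_nonneg[of C] by linarith
  then show ?thesis
    by (intro conjI absolute_norm_exists_iff)
qed

end
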